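(* Let $1<\gamma<3$, $P(\rho)=\rho^\gamma$, $c^2(\rho)=\gamma\rho^{\gamma-1}$, and let $L_0<L_1$. Suppose that the initial state $(u_0,\rho_0)$ at $x_1=L_0$, with $u_0>0,\ \rho_0>0$, is supersonic, i.e. $u_0^2>c^2(\rho_0)$, and that the (smooth) external force $\bar f:[L_0,L_1]\to\mathbb{R}$ satisfies $\bar f(x_1)>0$ for all $L_0<x_1<L_1$. Then there exist two positive constants $P_1<P_0$ such that, if the end pressure $P_e$ lies in $(P_1,P_0)$, there exists a unique transonic shock solution with end pressure $P_e$, consisting of $(\bar u^-,\bar\rho^-)$ and $(\bar u^+,\bar\rho^+)$ defined on $I^-=[L_0,L_s)$ and $I^+=(L_s,L_1)$ respectively, with a shock located at $x_1=L_s\in(L_0,L_1)$. In addition, the shock position $L_s$ increases as the exit pressure $P_e$ decreases. Furthermore, $L_s$ approaches $L_1$ if $P_e$ goes to $P_1$, and $L_s$ tends to $L_0$ if $P_e$ goes to $P_0$.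
   Context: The one-dimensional steady compressible flow with external force $\bar f$ is governed by $$(\bar\rho\bar u)'=0,\qquad \bar\rho\bar u\bar u'+\frac{d}{dx_1}P(\bar\rho)=\bar\rho\bar f(x_1).\qquad ( * )$$ A state $(u,\rho)$ with $u>0,\rho>0$ is supersonic if $u^2>c^2(\rho)$ and subsonic if $u^2<c^2(\rho)$. A transonic shock solution with end pressure $P_e$ and shock position $L_s\in(L_0,L_1)$ consists of functions $(\bar u^-,\bar\rho^-)$ (supersonic) on $I^-$ and $(\bar u^+,\bar\rho^+)$ (subsonic) on $I^+$, each smooth up to the endpoints of its interval, with positive velocity and density, such that: each solves $( * )$ on its interval; $\bar\rho^-(L_0)=\rho_0$ and $\bar u^-(L_0)=u_0$; at $x_1=L_s$ the Rankine–Hugoniot conditions $[\bar\rho\bar u](L_s)=0$ and $[\bar\rho\bar u^2+P(\bar\rho)](L_s)=0$ hold, where $[g](L_s)=g^+(L_s)-g^-(L_s)$; the entropy condition $P(\bar\rho^+(L_s))-P(\bar\rho^-(L_s))>0$ holds; and $P(\bar\rho^+(L_1))=P_e$. *)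

theory Defs
  imports "HOL-Analysis.Analysis"
begin

definition pressure :: "real \<Rightarrow> real \<Rightarrow> real" where
  "pressure \<gamma> \<rho> = \<rho> powr \<gamma>"

text \<open>The square \<open>c\<^sup>2(\<rho>)\<close> of the sound speed, that is \<open>P'(\<rho>)\<close>.\<close>

definition sound_speed_sq :: "real \<Rightarrow> real \<Rightarrow> real" where
  "sound_speed_sq \<gamma> \<rho> = \<gamma> * \<rho> powr (\<gamma> - 1)"

definition supersonic :: "real \<Rightarrow> real \<Rightarrow> real \<Rightarrow> bool" where
  "supersonic \<gamma> u \<rho> \<longleftrightarrow> u > 0 \<and> \<rho> > 0 \<and> u\<^sup>2 > sound_speed_sq \<gamma> \<rho>"

definition subsonic :: "real \<Rightarrow> real \<Rightarrow> real \<Rightarrow> bool" where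
  "subsonic \<gamma> u \<rho> \<longleftrightarrow> u > 0 \<and> \<rho> > 0 \<and> u\<^sup>2 < sound_speed_sq \<gamma> \<rho>"

text \<open>
  \<open>g\<close> is \<open>C\<^sup>\<infinity>\<close> on \<open>S\<close>: the sequence \<open>d\<close> lists its successive derivatives. This is only
  meaningful for sets without isolated points; on a compact interval \<open>{a..b}\<close> with \<open>a < b\<close> the
  derivatives at \<open>a\<close> and \<open>b\<close> are one-sided, which is smoothness up to the endpoints.
\<close>

definition smooth_on :: "real set \<Rightarrow> (real \<Rightarrow> real) \<Rightarrow> bool" where
  "smooth_on S g \<longleftrightarrow>
     (\<exists>d :: nat \<Rightarrow> real \<Rightarrow> real.
        (\<forall>x\<in>S. d 0 x = g x) \<and>
        (\<forall>k. \<forall>x\<in>S. (d k has_real_derivative d (Suc k) x) (at x within S)))"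

definition steady_flow ::
  "real \<Rightarrow> (real \<Rightarrow> real) \<Rightarrow> real set \<Rightarrow> (real \<Rightarrow> real) \<Rightarrow> (real \<Rightarrow> real) \<Rightarrow> bool" where
  "steady_flow \<gamma> f I u \<rho> \<longleftrightarrow>
     (\<forall>x\<in>I.
        ((\<lambda>y. \<rho> y * u y) has_real_derivative 0) (at x within I) \<and>
        (\<exists>u' p'.
           (u has_real_derivative u') (at x within I) \<and>
           ((\<lambda>y. pressure \<gamma> (\<rho> y)) has_real_derivative p') (at x within I) \<and>
           \<rho> x * u x * u' + p' = \<rho> x * f x))"

text \<open>
  The states \<open>(um, \<rho>m)\<close> and \<open>(up, \<rho>p)\<close> are the flows before and behind the shock. The equations
  and the sonic conditions are imposed on \<open>[L0, Ls)\<close> and \<open>(Ls, L1)\<close>; since both states are smooth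
  up to the endpoints of their intervals, their values at \<open>Ls\<close> and \<open>L1\<close> are the one-sided traces.
  Values of \<open>um, \<rho>m\<close> outside \<open>[L0, Ls]\<close> and of \<open>up, \<rho>p\<close> outside \<open>[Ls, L1]\<close> are irrelevant.
\<close>

definition transonic_shock ::
  "real \<Rightarrow> (real \<Rightarrow> real) \<Rightarrow> real \<Rightarrow> real \<Rightarrow> real \<Rightarrow> real \<Rightarrow> real \<Rightarrow> real \<Rightarrow>
   (real \<Rightarrow> real) \<Rightarrow> (real \<Rightarrow> real) \<Rightarrow> (real \<Rightarrow> real) \<Rightarrow> (real \<Rightarrow> real) \<Rightarrow> bool" where
  "transonic_shock \<gamma> f L0 L1 u0 \<rho>0 Pe Ls um \<rho>m up \<rho>p \<longleftrightarrow>
     L0 < Ls \<and> Ls < L1 \<and>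
     smooth_on {L0..Ls} um \<and> smooth_on {L0..Ls} \<rho>m \<and>
     smooth_on {Ls..L1} up \<and> smooth_on {Ls..L1} \<rho>p \<and>
     (\<forall>x\<in>{L0..<Ls}. supersonic \<gamma> (um x) (\<rho>m x)) \<and>
     (\<forall>x\<in>{Ls<..<L1}. subsonic \<gamma> (up x) (\<rho>p x)) \<and>
     steady_flow \<gamma> f {L0..<Ls} um \<rho>m \<and>
     steady_flow \<gamma> f {Ls<..<L1} up \<rho>p \<and>
     \<rho>m L0 = \<rho>0 \<and> um L0 = u0 \<and>
     \<rho>p Ls * up Ls - \<rho>m Ls * um Ls = 0 \<and>
     (\<rho>p Ls * (up Ls)\<^sup>2 + pressure \<gamma> (\<rho>p Ls)) -
       (\<rho>m Ls * (um Ls)\<^sup>2 + pressure \<gamma> (\<rho>m Ls)) = 0 \<and>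
     pressure \<gamma> (\<rho>p Ls) - pressure \<gamma> (\<rho>m Ls) > 0 \<and>
     pressure \<gamma> (\<rho>p L1) = Pe"

end

theory Submission
  imports Defs "HOL-Complex_Analysis.Conformal_Mappings" "HOL-Real_Asymp.Real_Asymp"
begin

text \<open>
  With constant mass flux \<open>J = \<rho> u\<close> the momentum equation integrates to Bernoulli's law
  \<open>B(\<rho>) = const + F\<close>, where \<open>B(\<rho>) = J\<^sup>2 / (2 \<rho>\<^sup>2) + \<gamma> / (\<gamma> - 1) \<rho> powr (\<gamma> - 1)\<close> and \<open>F' = f\<close>.
  As \<open>B\<close> decreases on supersonic densities, increases on subsonic ones and is unbounded at both
  ends, each flow is an explicit inverse branch of \<open>B\<close>. The flux \<open>M(\<rho>) = J\<^sup>2 / \<rho> + \<rho> powr \<gamma>\<close> has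
  the same monotonicity, since \<open>M' = \<rho> B'\<close>, so a supersonic state has exactly one subsonic state
  behind a shock.

  If the shock moves to the right, the density \<open>r\<close> ahead of it decreases, so \<open>M\<close> rises and the
  density \<open>q\<close> behind it increases. The function \<open>B - M / \<rho>\<^sub>*\<close>, with \<open>\<rho>\<^sub>*\<close> the sonic density, is
  strictly decreasing, and \<open>M(q) = M(r)\<close>; hence \<open>B(q) - B(r)\<close> decreases. Bernoulli's law on
  both sides of the shock shows that the exit value of \<open>B\<close> is \<open>B(q) - B(r)\<close> plus a constant, so
  the exit pressure is a continuous, strictly decreasing function of the shock position.
\<close>

section \<open>Smooth functions and inverse functions on the real line\<close>

lemma smooth_onI_derivative_closed:
  fixes g :: "real \<Rightarrow> real"
  assumes closed: "\<And>h. h \<in> A \<Longrightarrow> \<exists>h'\<in>A. \<forall>x\<in>S. (h has_real_derivative h' x) (at x within S)"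
    and "g \<in> A"
  shows "smooth_on S g"
proof -
  \<comment> \<open>Choice turns the closure property into an operator \<open>D\<close> on
    \<open>A\<close>; its iterates applied to \<open>g\<close> are the required list of
    derivatives.\<close>
  from closed obtain D where D: "\<And>h. h \<in> A \<Longrightarrow> D h \<in> A"
      "\<And>h x. h \<in> A \<Longrightarrow> x \<in> S \<Longrightarrow> (h has_real_derivative D h x) (at x within S)"
    by metis
  have mem: "(D ^^ k) g \<in> A" for k
    by (induction k) (auto intro: D \<open>g \<in> A\<close>)
  show ?thesis
    unfolding smooth_on_def
    by (rule exI[of _ "\<lambda>k. (D ^^ k) g"]) (auto intro: D(2) mem)
qed

lemma smooth_on_cong:
  assumes "smooth_on S g" and "\<And>x. x \<in> S \<Longrightarrow> h x = g x"
  shows "smooth_on S h"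
  using assms unfolding smooth_on_def by auto

lemma smooth_on_subset:
  assumes "smooth_on S g" and "T \<subseteq> S"
  shows "smooth_on T g"
proof -
  obtain d where d: "\<forall>x\<in>S. d 0 x = g x"
      "\<forall>k::nat. \<forall>x\<in>S. (d k has_real_derivative d (Suc k) x) (at x within S)"
    using assms(1) unfolding smooth_on_def by blast
  have "(d k has_real_derivative d (Suc k) x) (at x within T)" if "x \<in> T" for k x
    by (rule DERIV_subset[where s = S]) (use d \<open>T \<subseteq> S\<close> that in blast)+
  then show ?thesis
    unfolding smooth_on_def using d(1) \<open>T \<subseteq> S\<close> by blast
qed

lemma smooth_on_imp_continuous_on:
  assumes "smooth_on S g"
  shows "continuous_on S g"
proof -
  obtain d where d: "\<forall>x\<in>S. d 0 x = g x"
      "\<forall>k::nat. \<forall>x\<in>S. (d k has_real_derivative d (Suc k) x) (at x within S)"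
    using assms unfolding smooth_on_def by blast
  have "continuous_on S (d 0)"
    using d(2) by (meson DERIV_continuous continuous_on_eq_continuous_within)
  then show ?thesis
    using d(1) by (simp cong: continuous_on_cong)
qed

text \<open>
  If \<open>d\<close> lists the derivatives of \<open>f\<close> and \<open>r' = f / w\<close>, where \<open>w\<close> is a linear combination of powers
  of \<open>r\<close>, then this algebra is closed under differentiation, so that all its members are smooth.
\<close>

inductive_set generated_algebra ::
  "(nat \<Rightarrow> real \<Rightarrow> real) \<Rightarrow> (real \<Rightarrow> real) \<Rightarrow> (real \<Rightarrow> real) \<Rightarrow> (real \<Rightarrow> real) set"
  for d r w where
  const: "(\<lambda>x. c) \<in> generated_algebra d r w"
| deriv: "d k \<in> generated_algebra d r w"
| power: "(\<lambda>x. r x powr a) \<in> generated_algebra d r w"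
| recip: "(\<lambda>x. inverse (w x)) \<in> generated_algebra d r w"
| add: "\<lbrakk>g \<in> generated_algebra d r w; h \<in> generated_algebra d r w\<rbrakk>
    \<Longrightarrow> (\<lambda>x. g x + h x) \<in> generated_algebra d r w"
| mult: "\<lbrakk>g \<in> generated_algebra d r w; h \<in> generated_algebra d r w\<rbrakk>
    \<Longrightarrow> (\<lambda>x. g x * h x) \<in> generated_algebra d r w"

text \<open>The denominator has the shape of \<open>slope\<close>, a combination of two powers of
  the density. The factor \<open>e\<close> and exponent \<open>c\<close> let one statement serve
  both the density (\<open>e = c = 1\<close>) and the velocity (\<open>e = J\<close>,
  \<open>c = -1\<close>).\<close>

lemma smooth_on_autonomous_power_ode:
  fixes r f :: "real \<Rightarrow> real" and a b p q :: real
  defines "w \<equiv> \<lambda>x. a * r x powr p + b * r x powr q"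
  assumes f: "smooth_on S f"
    and pos: "\<And>x. x \<in> S \<Longrightarrow> r x > 0"
    and nz: "\<And>x. x \<in> S \<Longrightarrow> w x \<noteq> 0"
    and ode: "\<And>x. x \<in> S \<Longrightarrow> (r has_real_derivative f x / w x) (at x within S)"
  shows "smooth_on S (\<lambda>x. e * r x powr c)"
proof -
  obtain d where d0: "\<And>x. x \<in> S \<Longrightarrow> d 0 x = f x"
    and dS: "\<And>k x. x \<in> S \<Longrightarrow> (d k has_real_derivative d (Suc k) x) (at x within S)"
    using f unfolding smooth_on_def by blast
  let ?A = "generated_algebra d r w"
  \<comment> \<open>Written with \<open>d 0\<close> instead of \<open>f\<close>: the two agree only
    on \<open>S\<close>, and \<open>d 0\<close> is a generator of the algebra.\<close>
  define r' where "r' = (\<lambda>x. d 0 x * inverse (w x))"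
  have r'A: "r' \<in> ?A"
    unfolding r'_def by (intro generated_algebra.intros)
  have r': "(r has_real_derivative r' x) (at x within S)" if "x \<in> S" for x
    using ode[OF that] d0[OF that] by (simp add: r'_def field_simps)
  define P where "P = (\<lambda>e x. e * r x powr (e - 1) * r' x)"
  have PA: "P e \<in> ?A" for e
    unfolding P_def by (intro generated_algebra.intros r'A)
  have P: "((\<lambda>x. r x powr e) has_real_derivative P e x) (at x within S)" if "x \<in> S" for x e
    unfolding P_def
    by (rule derivative_eq_intros r' that pos refl | use pos[OF that] in \<open>simp add: powr_diff field_simps\<close>)+
  define w' where "w' = (\<lambda>x. a * P p x + b * P q x)"
  have w'A: "w' \<in> ?A"
    unfolding w'_def by (intro generated_algebra.intros PA)
  have w': "(w has_real_derivative w' x) (at x within S)" if "x \<in> S" for x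
    unfolding w_def w'_def by (rule derivative_eq_intros P that refl | simp)+
  show ?thesis
  proof (rule smooth_onI_derivative_closed)
    show "(\<lambda>x. e * r x powr c) \<in> ?A" by (intro generated_algebra.intros)
  next
    fix h assume "h \<in> ?A"
    then show "\<exists>h'\<in>?A. \<forall>x\<in>S. (h has_real_derivative h' x) (at x within S)"
    proof induction
      case (const c)
      show ?case
        by (rule bexI[of _ "\<lambda>x. 0"]) (auto intro: generated_algebra.intros)
    next
      case (deriv k)
      show ?case
        by (rule bexI[of _ "d (Suc k)"]) (auto intro: dS generated_algebra.intros)
    next
      case (power e)
      show ?case
        by (rule bexI[of _ "P e"]) (auto intro: P PA)
    next
      case recip
      \<comment> \<open>The derivative of a reciprocal, \<open>- w' / w^2\<close>, spelled out as a
        product of members of the algebra.\<close>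
      let ?h = "\<lambda>x. (-1) * (inverse (w x) * (inverse (w x) * w' x))"
      show ?case
      proof (rule bexI[of _ ?h])
        show "?h \<in> ?A" by (intro generated_algebra.intros w'A)
        show "\<forall>x\<in>S. ((\<lambda>x. inverse (w x)) has_real_derivative ?h x) (at x within S)"
          by (auto intro!: derivative_eq_intros w' nz)
      qed
    next
      case (add g h)
      then obtain g' h' where "g' \<in> ?A" "h' \<in> ?A"
        "\<forall>x\<in>S. (g has_real_derivative g' x) (at x within S)"
        "\<forall>x\<in>S. (h has_real_derivative h' x) (at x within S)" by blast
      then show ?case
        by (intro bexI[of _ "\<lambda>x. g' x + h' x"]) (auto intro: generated_algebra.intros derivative_intros)
    next
      case (mult g h)
      then obtain g' h' where *: "g' \<in> ?A" "h' \<in> ?A"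
        "\<forall>x\<in>S. (g has_real_derivative g' x) (at x within S)"
        "\<forall>x\<in>S. (h has_real_derivative h' x) (at x within S)" by blast
      show ?case
      proof (rule bexI[of _ "\<lambda>x. g' x * h x + h' x * g x"])
        show "(\<lambda>x. g' x * h x + h' x * g x) \<in> ?A"
          by (intro generated_algebra.intros * mult)
        show "\<forall>x\<in>S. ((\<lambda>x. g x * h x) has_real_derivative g' x * h x + h' x * g x) (at x within S)"
          using * by (auto intro!: DERIV_mult)
      qed
    qed
  qed
qed

text \<open>The inverse function theorem for an injective branch. It supplies the derivatives of all
  three inverse branches of \<open>bern\<close> and \<open>mom\<close> below.\<close>

lemma inv_into_has_real_derivative:
  fixes g :: "real \<Rightarrow> real"
  assumes "open S" and "inj_on g S"
    and g: "\<And>x. x \<in> S \<Longrightarrow> (g has_real_derivative g' x) (at x)"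
    and nz: "\<And>x. x \<in> S \<Longrightarrow> g' x \<noteq> 0"
    and y: "y \<in> g ` S"
  shows "(inv_into S g has_real_derivative inverse (g' (inv_into S g y))) (at y)"
proof -
  have x: "inv_into S g y \<in> S" "g (inv_into S g y) = y"
    using y by (auto intro: inv_into_into f_inv_into_f)
  have "continuous_on S g"
    using g by (intro continuous_at_imp_continuous_on) (auto intro: DERIV_isCont)
  from has_field_derivative_inverse_strong[OF g[OF x(1)] nz[OF x(1)] \<open>open S\<close> x(1) this]
  have "(inv_into S g has_real_derivative inverse (g' (inv_into S g y))) (at (g (inv_into S g y)))"
    using \<open>inj_on g S\<close> by simp
  then show ?thesis by (simp add: x)
qed

section \<open>Bernoulli function and momentum flux at fixed mass flux\<close>

locale gas_flow =
  fixes \<gamma> J :: real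
  assumes gamma: "1 < \<gamma>" and J: "0 < J"
begin

definition bern :: "real \<Rightarrow> real" where
  "bern r = J\<^sup>2 / (2 * r\<^sup>2) + \<gamma> / (\<gamma> - 1) * r powr (\<gamma> - 1)"

definition mom :: "real \<Rightarrow> real" where
  "mom r = J\<^sup>2 / r + r powr \<gamma>"

text \<open>For \<open>r > 0\<close> this equals
  \<open>(sound_speed_sq \<gamma> r - (J / r)^2) / r\<close>, so its sign separates subsonic from
  supersonic densities.\<close>

definition slope :: "real \<Rightarrow> real" where
  "slope r = \<gamma> * r powr (\<gamma> - 2) - J\<^sup>2 / r ^ 3"

text \<open>The density at which the velocity \<open>J / r\<close> equals the sound speed, that is,
  the positive root of \<open>\<gamma> * r powr (\<gamma> + 1) = J^2\<close>.\<close>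

definition sonic :: real where
  "sonic = (J\<^sup>2 / \<gamma>) powr (1 / (\<gamma> + 1))"

lemma sonic_pos: "0 < sonic"
  using gamma J by (simp add: sonic_def)

lemma has_derivative_bern:
  assumes "0 < r"
  shows "(bern has_real_derivative slope r) (at r)"
proof -
  have "((\<lambda>r. J\<^sup>2 / (2 * r\<^sup>2)) has_real_derivative - (J\<^sup>2 / r ^ 3)) (at r)"
    using assms by (auto intro!: derivative_eq_intros simp: field_simps eval_nat_numeral)
  moreover have "((\<lambda>r. r powr (\<gamma> - 1)) has_real_derivative (\<gamma> - 1) * r powr (\<gamma> - 2)) (at r)"
    using has_real_derivative_powr[OF assms, of "\<gamma> - 1"] by (simp add: algebra_simps)
  ultimately have "(bern has_real_derivative
      - (J\<^sup>2 / r ^ 3) + \<gamma> / (\<gamma> - 1) * ((\<gamma> - 1) * r powr (\<gamma> - 2))) (at r)"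
    unfolding bern_def[abs_def] by (intro DERIV_add DERIV_cmult)
  then show ?thesis
    using gamma by (simp add: slope_def)
qed

lemma has_derivative_mom:
  assumes "0 < r"
  shows "(mom has_real_derivative r * slope r) (at r)"
proof -
  have "r powr (\<gamma> - 1) = r * r powr (\<gamma> - 2)"
    using assms by (simp add: powr_mult_base)
  then show ?thesis
    unfolding mom_def[abs_def] slope_def using assms
    by (auto intro!: derivative_eq_intros simp: field_simps power2_eq_square power3_eq_cube)
qed

text \<open>Clearing denominators in \<open>slope\<close>, or in the comparison of
  \<open>(J / r)^2\<close> with the squared sound speed, leaves exactly this comparison. Both sign
  lemmas that follow reduce to it.\<close>

lemma powr_less_sonic_iff:
  assumes "0 < r"
  shows "\<gamma> * r powr (\<gamma> + 1) < J\<^sup>2 \<longleftrightarrow> r < sonic" "\<gamma> * r powr (\<gamma> + 1) > J\<^sup>2 \<longleftrightarrow> r > sonic"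
proof -
  have s: "\<gamma> * sonic powr (\<gamma> + 1) = J\<^sup>2"
    using gamma J by (simp add: sonic_def powr_powr)
  have mono: "a powr (\<gamma> + 1) < b powr (\<gamma> + 1) \<longleftrightarrow> a < b" if "0 < a" "0 < b" for a b
    using that gamma by (smt (verit) powr_less_mono2)
  show "\<gamma> * r powr (\<gamma> + 1) < J\<^sup>2 \<longleftrightarrow> r < sonic" "\<gamma> * r powr (\<gamma> + 1) > J\<^sup>2 \<longleftrightarrow> r > sonic"
    unfolding s[symmetric] using mono[of r sonic] mono[of sonic r] assms sonic_pos gamma by auto
qed

lemma slope_sign:
  assumes "0 < r"
  shows "slope r < 0 \<longleftrightarrow> r < sonic" "slope r > 0 \<longleftrightarrow> r > sonic"
proof -
  have "r powr (\<gamma> + 1) = r powr (\<gamma> - 2) * r ^ 3"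
    using assms by (simp add: powr_add[symmetric] add.commute flip: powr_numeral)
  then have "slope r = (\<gamma> * r powr (\<gamma> + 1) - J\<^sup>2) / r ^ 3"
    using assms by (simp add: slope_def field_simps)
  then show "slope r < 0 \<longleftrightarrow> r < sonic" "slope r > 0 \<longleftrightarrow> r > sonic"
    using powr_less_sonic_iff[OF assms] assms by (auto simp: divide_less_0_iff zero_less_divide_iff)
qed

lemma sonic_type_iff:
  assumes "0 < r"
  shows "supersonic \<gamma> (J / r) r \<longleftrightarrow> r < sonic" "subsonic \<gamma> (J / r) r \<longleftrightarrow> r > sonic"
proof -
  have "r powr (\<gamma> + 1) = r powr (\<gamma> - 1) * r\<^sup>2"
    using assms by (simp add: powr_add[symmetric] add.commute flip: powr_numeral)
  then have eq: "(J / r)\<^sup>2 - sound_speed_sq \<gamma> r = (J\<^sup>2 - \<gamma> * r powr (\<gamma> + 1)) / r\<^sup>2"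
    using assms by (simp add: sound_speed_sq_def field_simps power_divide)
  have "0 < (J / r)\<^sup>2 - sound_speed_sq \<gamma> r \<longleftrightarrow> \<gamma> * r powr (\<gamma> + 1) < J\<^sup>2"
    "(J / r)\<^sup>2 - sound_speed_sq \<gamma> r < 0 \<longleftrightarrow> \<gamma> * r powr (\<gamma> + 1) > J\<^sup>2"
    unfolding eq using assms by (simp_all add: zero_less_divide_iff divide_less_0_iff)
  then show "supersonic \<gamma> (J / r) r \<longleftrightarrow> r < sonic" "subsonic \<gamma> (J / r) r \<longleftrightarrow> r > sonic"
    using powr_less_sonic_iff[OF assms] assms J by (auto simp: supersonic_def subsonic_def)
qed

lemma bern_supersonic_less:
  assumes "0 < r" "r < q" "q \<le> sonic"
  shows "bern q < bern r"
proof (rule DERIV_neg_imp_decreasing_open[OF \<open>r < q\<close>])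
  show "\<exists>y. (bern has_real_derivative y) (at x) \<and> y < 0" if "r < x" "x < q" for x
    using that assms has_derivative_bern[of x] slope_sign[of x] by force
  show "continuous_on {r..q} bern"
    using assms by (intro continuous_at_imp_continuous_on ballI DERIV_isCont[OF has_derivative_bern]) auto
qed

lemma bern_subsonic_less:
  assumes "sonic \<le> r" "r < q"
  shows "bern r < bern q"
proof (rule DERIV_pos_imp_increasing_open[OF \<open>r < q\<close>])
  show "\<exists>y. (bern has_real_derivative y) (at x) \<and> 0 < y" if "r < x" "x < q" for x
    using that assms has_derivative_bern[of x] slope_sign[of x] sonic_pos by force
  show "continuous_on {r..q} bern"
    using assms sonic_pos
    by (intro continuous_at_imp_continuous_on ballI DERIV_isCont[OF has_derivative_bern]) auto
qed

lemma mom_supersonic_less: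
  assumes "0 < r" "r < q" "q \<le> sonic"
  shows "mom q < mom r"
proof (rule DERIV_neg_imp_decreasing_open[OF \<open>r < q\<close>])
  show "\<exists>y. (mom has_real_derivative y) (at x) \<and> y < 0" if "r < x" "x < q" for x
    using that assms has_derivative_mom[of x] slope_sign[of x] by (force simp: mult_less_0_iff)
  show "continuous_on {r..q} mom"
    using assms by (intro continuous_at_imp_continuous_on ballI DERIV_isCont[OF has_derivative_mom]) auto
qed

lemma mom_subsonic_less:
  assumes "sonic \<le> r" "r < q"
  shows "mom r < mom q"
proof (rule DERIV_pos_imp_increasing_open[OF \<open>r < q\<close>])
  show "\<exists>y. (mom has_real_derivative y) (at x) \<and> 0 < y" if "r < x" "x < q" for x
    using that assms has_derivative_mom[of x] slope_sign[of x] sonic_pos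
    by (force simp: zero_less_mult_iff)
  show "continuous_on {r..q} mom"
    using assms sonic_pos
    by (intro continuous_at_imp_continuous_on ballI DERIV_isCont[OF has_derivative_mom]) auto
qed

text \<open>Since \<open>mom' = r * bern'\<close>, the derivative is
  \<open>slope r * (1 - r / sonic)\<close>. Its two factors change sign at the same point
  \<open>sonic\<close> and in opposite directions, so the product is negative on both sides.\<close>

lemma bern_minus_mom_decreasing:
  assumes "0 < r" "r < q"
  shows "bern q - mom q / sonic < bern r - mom r / sonic"
proof -
  have D: "((\<lambda>r. bern r - mom r / sonic) has_real_derivative slope x * (1 - x / sonic)) (at x)"
    if "0 < x" for x
    using that by (auto intro!: derivative_eq_intros has_derivative_bern has_derivative_mom
        simp: field_simps sonic_pos[THEN less_imp_neq[THEN not_sym]])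
  have le: "slope x * (1 - x / sonic) < 0" if "0 < x" "x \<noteq> sonic" for x
    using that slope_sign[of x] sonic_pos by (cases "x < sonic") (auto simp: mult_less_0_iff)
  have cont: "continuous_on {a..b} (\<lambda>r. bern r - mom r / sonic)" if "0 < a" for a b
    using that by (intro continuous_at_imp_continuous_on ballI DERIV_isCont[OF D]) auto
  have step: "bern b - mom b / sonic < bern a - mom a / sonic"
    if "0 < a" "a < b" "\<not> (a < sonic \<and> sonic < b)" for a b
  proof (rule DERIV_neg_imp_decreasing_open[OF \<open>a < b\<close> _ cont[OF \<open>0 < a\<close>]])
    show "\<exists>y. ((\<lambda>r. bern r - mom r / sonic) has_real_derivative y) (at x) \<and> y < 0"
      if "a < x" "x < b" for x
    proof -
      have "0 < x" "x \<noteq> sonic" using that \<open>0 < a\<close> \<open>\<not> (a < sonic \<and> sonic < b)\<close> by auto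
      then show ?thesis using D le by blast
    qed
  qed
  \<comment> \<open>The derivative is zero at \<open>sonic\<close>, so an interval that straddles it
    is cut there into two admissible pieces.\<close>
  show ?thesis
    using step[of r q] step[of r sonic] step[of sonic q] assms sonic_pos by fastforce
qed

text \<open>The kinetic term blows up as the density tends to 0, so \<open>bern\<close> passes
  through every value above its sonic value before reaching \<open>sonic\<close>.\<close>

lemma ex_supersonic_bern:
  assumes "bern sonic < y"
  shows "\<exists>r\<in>{0<..<sonic}. bern r = y"
proof -
  have "filterlim bern at_top (at_right 0)"
    unfolding bern_def[abs_def] using gamma J by real_asymp
  then have "eventually (\<lambda>r. y < bern r) (at_right 0)"
    by (simp add: filterlim_at_top_dense)
  moreover have "eventually (\<lambda>r. r \<in> {0<..<sonic}) (at_right 0)"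
    using sonic_pos by (rule eventually_at_right_real)
  ultimately have "eventually (\<lambda>r. y < bern r \<and> r \<in> {0<..<sonic}) (at_right 0)"
    by (rule eventually_conj)
  then obtain q where q: "y < bern q" "0 < q" "q < sonic"
    by (auto dest: eventually_happens simp: trivial_limit_at_right_real)
  have "\<exists>r\<ge>q. r \<le> sonic \<and> bern r = y"
    by (rule IVT2') (use q assms in \<open>auto intro!: continuous_at_imp_continuous_on
        DERIV_isCont[OF has_derivative_bern]\<close>)
  then obtain r where "q \<le> r" "r \<le> sonic" "bern r = y" by blast
  moreover have "r \<noteq> sonic" using assms \<open>bern r = y\<close> by auto
  ultimately show ?thesis using q by (intro bexI[of _ r]) auto
qed

text \<open>Because \<gamma> > 1, the power term is unbounded at large densities, and the
  intermediate value theorem applies on the subsonic side. The same argument serves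
  \<open>mom\<close> in the next lemma.\<close>

lemma ex_subsonic_bern:
  assumes "bern sonic < y"
  shows "\<exists>r\<in>{sonic<..}. bern r = y"
proof -
  have "filterlim bern at_top at_top"
    unfolding bern_def[abs_def] using gamma J by real_asymp
  then have "eventually (\<lambda>r. y < bern r \<and> sonic < r) at_top"
    by (simp add: filterlim_at_top_dense eventually_conj_iff eventually_gt_at_top)
  then obtain q where q: "y < bern q" "sonic < q"
    by (auto dest: eventually_happens)
  have "\<exists>r\<ge>sonic. r \<le> q \<and> bern r = y"
    by (rule IVT') (use q assms sonic_pos in \<open>auto intro!: continuous_at_imp_continuous_on
        DERIV_isCont[OF has_derivative_bern]\<close>)
  then obtain r where "sonic \<le> r" "bern r = y" by blast
  moreover have "r \<noteq> sonic" using assms \<open>bern r = y\<close> by auto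
  ultimately show ?thesis by (intro bexI[of _ r]) auto
qed

lemma ex_subsonic_mom:
  assumes "mom sonic < y"
  shows "\<exists>r\<in>{sonic<..}. mom r = y"
proof -
  have "filterlim mom at_top at_top"
    unfolding mom_def[abs_def] using gamma J by real_asymp
  then have "eventually (\<lambda>r. y < mom r \<and> sonic < r) at_top"
    by (simp add: filterlim_at_top_dense eventually_conj_iff eventually_gt_at_top)
  then obtain q where q: "y < mom q" "sonic < q"
    by (auto dest: eventually_happens)
  have "\<exists>r\<ge>sonic. r \<le> q \<and> mom r = y"
    by (rule IVT') (use q assms sonic_pos in \<open>auto intro!: continuous_at_imp_continuous_on
        DERIV_isCont[OF has_derivative_mom]\<close>)
  then obtain r where "sonic \<le> r" "mom r = y" by blast
  moreover have "r \<noteq> sonic" using assms \<open>mom r = y\<close> by auto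
  ultimately show ?thesis by (intro bexI[of _ r]) auto
qed

end

section \<open>Inverse branches and integration of the flow equations\<close>

lemma steady_flow_subset:
  assumes "steady_flow \<gamma> f I u \<rho>" and "T \<subseteq> I"
  shows "steady_flow \<gamma> f T u \<rho>"
  unfolding steady_flow_def
proof (intro ballI conjI)
  fix x assume "x \<in> T"
  then have x: "x \<in> I" using assms by blast
  show "((\<lambda>y. \<rho> y * u y) has_real_derivative 0) (at x within T)"
    using assms x unfolding steady_flow_def by (blast intro: DERIV_subset)
  show "\<exists>u' p'. (u has_real_derivative u') (at x within T) \<and>
      ((\<lambda>y. pressure \<gamma> (\<rho> y)) has_real_derivative p') (at x within T) \<and>
      \<rho> x * u x * u' + p' = \<rho> x * f x"
    using assms x unfolding steady_flow_def by (meson DERIV_subset)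
qed

text \<open>The equations hold on open intervals, while initial, shock and exit data live at
  endpoints; continuity carries conserved quantities there.\<close>

lemma constant_on_closed_interval:
  fixes g :: "real \<Rightarrow> real"
  assumes "a < b" and "continuous_on {a..b} g"
    and "\<And>x. x \<in> {a<..<b} \<Longrightarrow> (g has_real_derivative 0) (at x within {a<..<b})"
    and "x \<in> {a..b}" and "y \<in> {a..b}"
  shows "g x = g y"
proof -
  obtain c where c: "\<forall>x\<in>{a<..<b}. g x = c"
    using has_field_derivative_zero_constant[of "{a<..<b}" g] assms(3) by auto
  have "g z = c" if "z \<in> {a..b}" for z
    by (rule continuous_constant_on_closure[of "{a<..<b}"]) (use assms c that in auto)
  then show ?thesis using assms(4,5) by metis
qed

context gas_flow
begin

text \<open>Outside the image of the branch \<open>inv_into\<close> has an arbitrary value; the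
  facts about the branches therefore assume an argument above the sonic value of \<open>bern\<close>
  or \<open>mom\<close>.\<close>

definition sup_branch :: "real \<Rightarrow> real" where
  "sup_branch = inv_into {0<..<sonic} bern"

definition sub_branch :: "real \<Rightarrow> real" where
  "sub_branch = inv_into {sonic<..} bern"

definition jump_branch :: "real \<Rightarrow> real" where
  "jump_branch = inv_into {sonic<..} mom"

lemma inj_branches:
  shows "inj_on bern {0<..<sonic}" "inj_on bern {sonic<..}" "inj_on mom {sonic<..}"
proof -
  have "bern x \<noteq> bern y" if "x < y" "0 < x" "y < sonic" for x y
    using bern_supersonic_less[of x y] that by simp
  then show "inj_on bern {0<..<sonic}"
    by (intro linorder_inj_onI) auto
  have "bern x \<noteq> bern y" "mom x \<noteq> mom y" if "x < y" "sonic < x" for x y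
    using bern_subsonic_less[of x y] mom_subsonic_less[of x y] that by simp_all
  then show "inj_on bern {sonic<..}" "inj_on mom {sonic<..}"
    by (intro linorder_inj_onI; auto)+
qed

lemma sup_branch_bern: "0 < r \<Longrightarrow> r < sonic \<Longrightarrow> sup_branch (bern r) = r"
  unfolding sup_branch_def by (simp add: inj_branches)

lemma sub_branch_bern: "sonic < r \<Longrightarrow> sub_branch (bern r) = r"
  unfolding sub_branch_def by (simp add: inj_branches)

lemma jump_branch_mom: "sonic < r \<Longrightarrow> jump_branch (mom r) = r"
  unfolding jump_branch_def by (simp add: inj_branches)

lemma sup_branch:
  assumes "bern sonic < y"
  shows "0 < sup_branch y" "sup_branch y < sonic" "bern (sup_branch y) = y"
    "(sup_branch has_real_derivative inverse (slope (sup_branch y))) (at y)"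
proof -
  obtain r where r: "r \<in> {0<..<sonic}" "bern r = y"
    using ex_supersonic_bern[OF assms] by blast
  then show "0 < sup_branch y" "sup_branch y < sonic" "bern (sup_branch y) = y"
    using sup_branch_bern[of r] by auto
  show "(sup_branch has_real_derivative inverse (slope (sup_branch y))) (at y)"
    unfolding sup_branch_def
  proof (rule inv_into_has_real_derivative)
    show "slope x \<noteq> 0" if "x \<in> {0<..<sonic}" for x
      using that slope_sign[of x] by force
  qed (use r inj_branches in \<open>auto intro: has_derivative_bern\<close>)
qed

lemma sub_branch:
  assumes "bern sonic < y"
  shows "sonic < sub_branch y" "bern (sub_branch y) = y"
    "(sub_branch has_real_derivative inverse (slope (sub_branch y))) (at y)"
proof -
  obtain r where r: "r \<in> {sonic<..}" "bern r = y"
    using ex_subsonic_bern[OF assms] by blast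
  then show "sonic < sub_branch y" "bern (sub_branch y) = y"
    using sub_branch_bern[of r] by auto
  show "(sub_branch has_real_derivative inverse (slope (sub_branch y))) (at y)"
    unfolding sub_branch_def
  proof (rule inv_into_has_real_derivative)
    show "slope x \<noteq> 0" if "x \<in> {sonic<..}" for x
      using that slope_sign[of x] sonic_pos by force
    show "(bern has_real_derivative slope x) (at x)" if "x \<in> {sonic<..}" for x
      using that sonic_pos by (intro has_derivative_bern) auto
  qed (use r inj_branches in auto)
qed

lemma jump_branch:
  assumes "mom sonic < y"
  shows "sonic < jump_branch y" "mom (jump_branch y) = y"
    "(jump_branch has_real_derivative inverse (jump_branch y * slope (jump_branch y))) (at y)"
proof -
  obtain r where r: "r \<in> {sonic<..}" "mom r = y"
    using ex_subsonic_mom[OF assms] by blast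
  then show "sonic < jump_branch y" "mom (jump_branch y) = y"
    using jump_branch_mom[of r] by auto
  show "(jump_branch has_real_derivative inverse (jump_branch y * slope (jump_branch y))) (at y)"
    unfolding jump_branch_def
  proof (rule inv_into_has_real_derivative)
    show "x * slope x \<noteq> 0" if "x \<in> {sonic<..}" for x
      using that slope_sign[of x] sonic_pos by force
    show "(mom has_real_derivative x * slope x) (at x)" if "x \<in> {sonic<..}" for x
      using that sonic_pos by (intro has_derivative_mom) auto
  qed (use r inj_branches in auto)
qed

text \<open>Mass conservation fixes the flux at its value \<open>J\<close> at \<open>c\<close>; the
  momentum equation divided by the density is then an exact derivative. The base point
  \<open>c\<close> will be \<open>L0\<close> for the flow ahead of the shock and \<open>Ls\<close>
  for the flow behind it.\<close>

lemma steady_flow_bernoulli: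
  assumes "a < b" and flow: "steady_flow \<gamma> f {a<..<b} u \<rho>"
    and cont: "continuous_on {a..b} u" "continuous_on {a..b} \<rho>"
    and pos: "\<And>x. x \<in> {a<..<b} \<Longrightarrow> 0 < \<rho> x"
    and F: "\<And>x. x \<in> {a..b} \<Longrightarrow> (F has_real_derivative f x) (at x within {a..b})"
    and c: "c \<in> {a..b}" "\<rho> c * u c = J" and x: "x \<in> {a..b}"
  shows "0 < \<rho> x" "u x = J / \<rho> x" "bern (\<rho> x) - F x = bern (\<rho> c) - F c"
proof -
  have flux: "\<rho> y * u y = J" if "y \<in> {a..b}" for y
    using constant_on_closed_interval[OF \<open>a < b\<close>, of "\<lambda>y. \<rho> y * u y" y c] cont flow c that
    by (auto intro: continuous_intros simp: steady_flow_def)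
  \<comment> \<open>Passing to the closure keeps only a weak inequality; zero density at an endpoint
    is excluded because the flux there is \<open>J > 0\<close>.\<close>
  have pos': "0 < \<rho> y" if "y \<in> {a..b}" for y
  proof -
    have "0 \<le> \<rho> y"
      by (rule continuous_ge_on_closure[of "{a<..<b}"]) (use \<open>a < b\<close> cont pos that in \<open>auto intro: less_imp_le\<close>)
    then show ?thesis using flux[OF that] J by (cases "\<rho> y = 0") auto
  qed
  have u: "u y = J / \<rho> y" if "y \<in> {a..b}" for y
    using flux[OF that] pos'[OF that] by (simp add: field_simps)
  \<comment> \<open>Expressing the enthalpy through the pressure avoids having to differentiate \<open>\<rho>\<close>.\<close>
  define E where "E = (\<lambda>y. (u y)\<^sup>2 / 2 + \<gamma> / (\<gamma> - 1) * pressure \<gamma> (\<rho> y) powr ((\<gamma> - 1) / \<gamma>))"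
  have E: "E y = bern (\<rho> y)" if "y \<in> {a..b}" for y
    using gamma pos'[OF that] by (simp add: E_def bern_def pressure_def powr_powr u[OF that] power_divide)
  have "((\<lambda>y. E y - F y) has_real_derivative 0) (at y within {a<..<b})" if y: "y \<in> {a<..<b}" for y
  proof -
    obtain u' p' where u': "(u has_real_derivative u') (at y within {a<..<b})"
      and p': "((\<lambda>y. pressure \<gamma> (\<rho> y)) has_real_derivative p') (at y within {a<..<b})"
      and eq: "\<rho> y * u y * u' + p' = \<rho> y * f y"
      using flow y unfolding steady_flow_def by blast
    have r: "0 < \<rho> y" using pos y by simp
    \<comment> \<open>The chain rule leaves this power of the pressure, which is the reciprocal of
      the density: precisely the factor by which the momentum equation has to be divided.\<close>
    have exponent: "(\<gamma> - 1) / \<gamma> - 1 = - (1 / \<gamma>)" using gamma by (simp add: field_simps)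
    have P: "pressure \<gamma> (\<rho> y) powr ((\<gamma> - 1) / \<gamma> - 1) = inverse (\<rho> y)"
      unfolding exponent using r gamma by (simp add: pressure_def powr_powr powr_minus)
    have "0 < pressure \<gamma> (\<rho> y)"
      using r by (simp add: pressure_def)
    from DERIV_chain2[OF has_real_derivative_powr[OF this, of "(\<gamma> - 1) / \<gamma>"] p']
    have "((\<lambda>y. pressure \<gamma> (\<rho> y) powr ((\<gamma> - 1) / \<gamma>)) has_real_derivative
        (\<gamma> - 1) / \<gamma> * inverse (\<rho> y) * p') (at y within {a<..<b})"
      unfolding P .
    then have "(E has_real_derivative
        u y * u' + \<gamma> / (\<gamma> - 1) * ((\<gamma> - 1) / \<gamma> * inverse (\<rho> y) * p')) (at y within {a<..<b})"
      unfolding E_def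
      by (intro DERIV_add DERIV_cmult) (auto intro!: derivative_eq_intros u')
    moreover have "u y * u' + \<gamma> / (\<gamma> - 1) * ((\<gamma> - 1) / \<gamma> * inverse (\<rho> y) * p') = f y"
    proof -
      have "p' = \<rho> y * (f y - u y * u')"
        using eq by (simp add: algebra_simps)
      then show ?thesis
        using r gamma by (simp add: inverse_eq_divide)
    qed
    moreover have "(F has_real_derivative f y) (at y within {a<..<b})"
      using F[of y] y by (auto intro: DERIV_subset[where s = "{a..b}"])
    ultimately show ?thesis
      using DERIV_diff by fastforce
  qed
  moreover have "continuous_on {a..b} (\<lambda>y. E y - F y)"
  proof (intro continuous_on_diff)
    show "continuous_on {a..b} F"
      using F by (meson DERIV_continuous continuous_on_eq_continuous_within)
    show "continuous_on {a..b} E"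
      unfolding E_def pressure_def
      using pos' gamma by (intro continuous_intros cont) (auto simp: less_imp_neq[THEN not_sym])
  qed
  ultimately have "E x - F x = E c - F c"
    using constant_on_closed_interval[OF \<open>a < b\<close>, of "\<lambda>y. E y - F y" x c] x c by blast
  then show "0 < \<rho> x" "u x = J / \<rho> x" "bern (\<rho> x) - F x = bern (\<rho> c) - F c"
    using pos' u E x c by auto
qed

text \<open>With velocity \<open>J / \<rho>\<close>, the left side of the momentum equation is
  \<open>\<rho> * slope \<rho>\<close> times the derivative of the density, so the equation becomes
  the scalar ODE assumed here.\<close>

lemma steady_flowI:
  assumes pos: "\<And>x. x \<in> I \<Longrightarrow> 0 < \<rho> x" and nz: "\<And>x. x \<in> I \<Longrightarrow> slope (\<rho> x) \<noteq> 0"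
    and ode: "\<And>x. x \<in> I \<Longrightarrow> (\<rho> has_real_derivative f x / slope (\<rho> x)) (at x within I)"
  shows "steady_flow \<gamma> f I (\<lambda>x. J / \<rho> x) \<rho>"
  unfolding steady_flow_def
proof (intro ballI conjI exI)
  fix x assume x: "x \<in> I"
  let ?d = "f x / slope (\<rho> x)"
  note [derivative_intros] = ode[OF x]
  have r: "0 < \<rho> x" using pos x .
  show u': "((\<lambda>y. J / \<rho> y) has_real_derivative - J * ?d / (\<rho> x)\<^sup>2) (at x within I)"
    using r by (auto intro!: derivative_eq_intros simp: power2_eq_square)
  have "?d * (J / \<rho> x) + - J * ?d / (\<rho> x)\<^sup>2 * \<rho> x = 0"
    using r by (simp add: power2_eq_square)
  then show "((\<lambda>y. \<rho> y * (J / \<rho> y)) has_real_derivative 0) (at x within I)"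
    using DERIV_mult[OF ode[OF x] u'] by simp
  show "((\<lambda>y. pressure \<gamma> (\<rho> y)) has_real_derivative \<gamma> * \<rho> x powr (\<gamma> - 1) * ?d) (at x within I)"
    unfolding pressure_def
    by (rule DERIV_chain2[OF has_real_derivative_powr[OF r] ode[OF x]])
  have "\<rho> x powr (\<gamma> - 1) = \<rho> x * \<rho> x powr (\<gamma> - 2)"
    using r by (simp add: powr_mult_base)
  then have "\<rho> x * (J / \<rho> x) * (- J / (\<rho> x)\<^sup>2) + \<gamma> * \<rho> x powr (\<gamma> - 1) = \<rho> x * slope (\<rho> x)"
    using r by (simp add: slope_def field_simps power2_eq_square power3_eq_cube)
  then have "(\<rho> x * (J / \<rho> x) * (- J / (\<rho> x)\<^sup>2) + \<gamma> * \<rho> x powr (\<gamma> - 1)) * ?d = \<rho> x * f x"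
    using nz[OF x] by simp
  then show "\<rho> x * (J / \<rho> x) * (- J * ?d / (\<rho> x)\<^sup>2) + \<gamma> * \<rho> x powr (\<gamma> - 1) * ?d = \<rho> x * f x"
    by (simp add: algebra_simps)
qed

lemma smooth_on_flow:
  assumes f: "smooth_on S f"
    and pos: "\<And>x. x \<in> S \<Longrightarrow> 0 < \<rho> x" and nz: "\<And>x. x \<in> S \<Longrightarrow> slope (\<rho> x) \<noteq> 0"
    and ode: "\<And>x. x \<in> S \<Longrightarrow> (\<rho> has_real_derivative f x / slope (\<rho> x)) (at x within S)"
  shows "smooth_on S \<rho>" "smooth_on S (\<lambda>x. J / \<rho> x)"
proof -
  have slope: "slope (\<rho> x) = \<gamma> * \<rho> x powr (\<gamma> - 2) + (- (J\<^sup>2)) * \<rho> x powr (- 3)" if "x \<in> S" for x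
    using pos[OF that] by (simp add: slope_def powr_minus divide_inverse)
  have *: "smooth_on S (\<lambda>x. e * \<rho> x powr c)" for e c
    by (rule smooth_on_autonomous_power_ode[OF f pos,
          where a = \<gamma> and p = "\<gamma> - 2" and b = "- (J\<^sup>2)" and q = "- 3"])
      (use nz ode slope in force)+
  show "smooth_on S \<rho>"
    by (rule smooth_on_cong[OF *[of 1 1]]) (use pos in force)
  show "smooth_on S (\<lambda>x. J / \<rho> x)"
    by (rule smooth_on_cong[OF *[of J "- 1"]]) (use pos in \<open>force simp: powr_minus_divide\<close>)
qed

end

section \<open>Explicit flows for a given shock position, and their uniqueness\<close>

locale nozzle_flow = gas_flow +
  fixes f F :: "real \<Rightarrow> real" and L0 L1 \<rho>0 :: real
  assumes smooth_f: "smooth_on {L0..L1} f"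
    and F: "\<And>x. x \<in> {L0..L1} \<Longrightarrow> (F has_real_derivative f x) (at x within {L0..L1})"
    and F_L0: "F L0 = 0"
    and F_mono: "\<And>x y. L0 \<le> x \<Longrightarrow> x < y \<Longrightarrow> y \<le> L1 \<Longrightarrow> F x < F y"
    and rho0: "0 < \<rho>0" "\<rho>0 < sonic"
begin

text \<open>
  \<open>pre\<close> is the density of the supersonic flow; for a shock at \<open>s\<close>, \<open>behind s\<close> is the density
  immediately behind it and \<open>post s\<close> that of the subsonic flow downstream.
\<close>

definition pre :: "real \<Rightarrow> real" where
  "pre x = sup_branch (bern \<rho>0 + F x)"

definition behind :: "real \<Rightarrow> real" where
  "behind s = jump_branch (mom (pre s))"

definition post :: "real \<Rightarrow> real \<Rightarrow> real" where
  "post s x = sub_branch (bern (behind s) + (F x - F s))"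

definition exit_pressure :: "real \<Rightarrow> real" where
  "exit_pressure s = pressure \<gamma> (post s L1)"

lemma F_mono_le: "L0 \<le> x \<Longrightarrow> x \<le> y \<Longrightarrow> y \<le> L1 \<Longrightarrow> F x \<le> F y"
  using F_mono[of x y] by (cases "x = y") auto

lemma F_derivative_subset:
  "x \<in> T \<Longrightarrow> T \<subseteq> {L0..L1} \<Longrightarrow> (F has_real_derivative f x) (at x within T)"
  using F by (rule DERIV_subset) auto

lemma pre:
  assumes "x \<in> {L0..L1}"
  shows "0 < pre x" "pre x < sonic" "bern (pre x) = bern \<rho>0 + F x"
    "(pre has_real_derivative f x / slope (pre x)) (at x within {L0..L1})"
proof -
  have "0 \<le> F x" using F_mono_le[of L0 x] F_L0 assms by simp
  \<comment> \<open>The force only raises the Bernoulli value, so the supersonic flow never turns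
    sonic and extends through the whole nozzle.\<close>
  then have y: "bern sonic < bern \<rho>0 + F x"
    using bern_supersonic_less[of \<rho>0 sonic] rho0 by simp
  show "0 < pre x" "pre x < sonic" "bern (pre x) = bern \<rho>0 + F x"
    using sup_branch[OF y] by (simp_all add: pre_def)
  have "((\<lambda>x. bern \<rho>0 + F x) has_real_derivative f x) (at x within {L0..L1})"
    using F[OF assms] by (auto intro!: derivative_eq_intros)
  from DERIV_chain2[OF sup_branch(4)[OF y] this]
  show "(pre has_real_derivative f x / slope (pre x)) (at x within {L0..L1})"
    by (simp add: pre_def[abs_def] divide_inverse mult.commute)
qed

lemma behind:
  assumes "s \<in> {L0..L1}"
  shows "sonic < behind s" "mom (behind s) = mom (pre s)"
    "continuous (at s within {L0..L1}) behind"
proof -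
  \<comment> \<open>The momentum flux is least at \<open>sonic\<close>, so the value ahead of the
    shock is also attained at a subsonic density.\<close>
  have y: "mom sonic < mom (pre s)"
    using mom_supersonic_less[of "pre s" sonic] pre[OF assms] by simp
  show "sonic < behind s" "mom (behind s) = mom (pre s)"
    using jump_branch[OF y] by (simp_all add: behind_def)
  have "((\<lambda>s. mom (pre s)) has_real_derivative
      pre s * slope (pre s) * (f s / slope (pre s))) (at s within {L0..L1})"
    by (rule DERIV_chain2[OF has_derivative_mom pre(4)]) (use pre[OF assms] assms in auto)
  from DERIV_chain2[OF jump_branch(3)[OF y] this]
  show "continuous (at s within {L0..L1}) behind"
    unfolding behind_def[abs_def] by (rule DERIV_continuous)
qed

lemma post:
  assumes "s \<in> {L0..L1}" "x \<in> {s..L1}"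
  shows "sonic < post s x" "bern (post s x) = bern (behind s) + (F x - F s)"
    "(post s has_real_derivative f x / slope (post s x)) (at x within {s..L1})"
proof -
  have "0 \<le> F x - F s" using F_mono_le[of s x] assms by simp
  then have y: "bern sonic < bern (behind s) + (F x - F s)"
    using bern_subsonic_less[of sonic "behind s"] behind[OF assms(1)] by simp
  show "sonic < post s x" "bern (post s x) = bern (behind s) + (F x - F s)"
    using sub_branch[OF y] by (simp_all add: post_def)
  have "((\<lambda>x. bern (behind s) + (F x - F s)) has_real_derivative f x) (at x within {s..L1})"
    using F_derivative_subset[of x "{s..L1}"] assms by (auto intro!: derivative_eq_intros)
  from DERIV_chain2[OF sub_branch(3)[OF y] this]
  show "(post s has_real_derivative f x / slope (post s x)) (at x within {s..L1})"
    by (simp add: post_def[abs_def] divide_inverse mult.commute)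
qed

lemma post_shock: "s \<in> {L0..L1} \<Longrightarrow> post s s = behind s"
  using behind[of s] by (simp add: post_def sub_branch_bern)

lemma pressure_less_iff: "0 < r \<Longrightarrow> 0 < q \<Longrightarrow> pressure \<gamma> r < pressure \<gamma> q \<longleftrightarrow> r < q"
  unfolding pressure_def using gamma by (smt (verit) powr_less_mono2)

lemma momentum_flux_eq_mom: "0 < r \<Longrightarrow> r * (J / r)\<^sup>2 + pressure \<gamma> r = mom r"
  by (simp add: mom_def pressure_def field_simps power2_eq_square)

text \<open>Every interior position admits a shock, and the end pressure is then dictated by it.
  Solving for a prescribed end pressure thus reduces to inverting
  \<open>exit_pressure\<close>.\<close>

lemma transonic_shock_exists:
  assumes "L0 < Ls" "Ls < L1"
  shows "transonic_shock \<gamma> f L0 L1 (J / \<rho>0) \<rho>0 (exit_pressure Ls) Ls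
    (\<lambda>x. J / pre x) pre (\<lambda>x. J / post Ls x) (post Ls)"
proof -
  have Ls: "Ls \<in> {L0..L1}" using assms by simp
  have pre_ode: "(pre has_real_derivative f x / slope (pre x)) (at x within T)"
    if "x \<in> T" "T \<subseteq> {L0..L1}" for x T
    by (rule DERIV_subset[OF pre(4)]) (use that in auto)
  have post_ode: "(post Ls has_real_derivative f x / slope (post Ls x)) (at x within T)"
    if "x \<in> T" "T \<subseteq> {Ls..L1}" for x T
    by (rule DERIV_subset[OF post(3)[OF Ls]]) (use that in auto)
  have pre_nz: "slope (pre x) \<noteq> 0" if "x \<in> {L0..L1}" for x
    using slope_sign[of "pre x"] pre[OF that] by simp
  have post_pos: "0 < post Ls x" if "x \<in> {Ls..L1}" for x
    using post(1)[OF Ls that] sonic_pos by simp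
  have post_nz: "slope (post Ls x) \<noteq> 0" if "x \<in> {Ls..L1}" for x
    using slope_sign(2)[OF post_pos[OF that]] post(1)[OF Ls that] by simp
  have "smooth_on {L0..Ls} pre" "smooth_on {L0..Ls} (\<lambda>x. J / pre x)"
    by (rule smooth_on_flow[OF smooth_on_subset[OF smooth_f]];
        (rule pre_ode pre_nz pre(1))?; use assms in auto)+
  moreover have "smooth_on {Ls..L1} (post Ls)" "smooth_on {Ls..L1} (\<lambda>x. J / post Ls x)"
    by (rule smooth_on_flow[OF smooth_on_subset[OF smooth_f]];
        (rule post_ode post_nz post_pos)?; use assms in auto)+
  moreover have "steady_flow \<gamma> f {L0..<Ls} (\<lambda>x. J / pre x) pre"
    by (rule steady_flowI; (rule pre_ode pre_nz pre(1))?; use assms in auto)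
  moreover have "steady_flow \<gamma> f {Ls<..<L1} (\<lambda>x. J / post Ls x) (post Ls)"
    by (rule steady_flowI; (rule post_ode post_nz post_pos)?; use assms in auto)
  moreover have "\<forall>x\<in>{L0..<Ls}. supersonic \<gamma> (J / pre x) (pre x)"
    using assms pre sonic_type_iff by auto
  moreover have "\<forall>x\<in>{Ls<..<L1}. subsonic \<gamma> (J / post Ls x) (post Ls x)"
    using assms post(1)[OF Ls] post_pos sonic_type_iff by auto
  moreover have "pre L0 = \<rho>0"
    using rho0 by (simp add: pre_def F_L0 sup_branch_bern)
  moreover have "post Ls Ls * (J / post Ls Ls) - pre Ls * (J / pre Ls) = 0"
    using pre[OF Ls] post_pos[of Ls] assms by simp
  moreover have "(post Ls Ls * (J / post Ls Ls)\<^sup>2 + pressure \<gamma> (post Ls Ls)) -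
      (pre Ls * (J / pre Ls)\<^sup>2 + pressure \<gamma> (pre Ls)) = 0"
    using pre[OF Ls] post_pos[of Ls] assms post_shock[OF Ls] behind(2)[OF Ls]
    by (simp add: momentum_flux_eq_mom)
  moreover have "pressure \<gamma> (post Ls Ls) - pressure \<gamma> (pre Ls) > 0"
    using pressure_less_iff[of "pre Ls" "post Ls Ls"] pre[OF Ls] post(1)[OF Ls, of Ls] post_pos[of Ls] assms
    by simp
  ultimately show ?thesis
    unfolding transonic_shock_def exit_pressure_def using assms by simp
qed

text \<open>Bernoulli's law fixes \<open>bern\<close> of the density at each point, the sonic type
  selects the branch, and the jump conditions with entropy fix the state behind the shock. Hence the
  position determines both flows and the end pressure.\<close>

lemma transonic_shock_unique:
  assumes shock: "transonic_shock \<gamma> f L0 L1 (J / \<rho>0) \<rho>0 Pe Ls um \<rho>m up \<rho>p"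
  shows "Pe = exit_pressure Ls"
    "\<And>x. x \<in> {L0..Ls} \<Longrightarrow> \<rho>m x = pre x \<and> um x = J / pre x"
    "\<And>x. x \<in> {Ls..L1} \<Longrightarrow> \<rho>p x = post Ls x \<and> up x = J / post Ls x"
proof -
  have ord: "L0 < Ls" "Ls < L1"
    and sm: "smooth_on {L0..Ls} um" "smooth_on {L0..Ls} \<rho>m" "smooth_on {Ls..L1} up" "smooth_on {Ls..L1} \<rho>p"
    and sup: "\<And>x. x \<in> {L0..<Ls} \<Longrightarrow> supersonic \<gamma> (um x) (\<rho>m x)"
    and sub: "\<And>x. x \<in> {Ls<..<L1} \<Longrightarrow> subsonic \<gamma> (up x) (\<rho>p x)"
    and flow: "steady_flow \<gamma> f {L0..<Ls} um \<rho>m" "steady_flow \<gamma> f {Ls<..<L1} up \<rho>p"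
    and init: "\<rho>m L0 = \<rho>0" "um L0 = J / \<rho>0"
    and RH: "\<rho>p Ls * up Ls = \<rho>m Ls * um Ls"
      "\<rho>p Ls * (up Ls)\<^sup>2 + pressure \<gamma> (\<rho>p Ls) = \<rho>m Ls * (um Ls)\<^sup>2 + pressure \<gamma> (\<rho>m Ls)"
    and entropy: "pressure \<gamma> (\<rho>m Ls) < pressure \<gamma> (\<rho>p Ls)"
    and exit: "pressure \<gamma> (\<rho>p L1) = Pe"
    using shock by (auto simp: transonic_shock_def)
  have Ls: "Ls \<in> {L0..L1}" using ord by simp
  note cont = sm[THEN smooth_on_imp_continuous_on]
  have "steady_flow \<gamma> f {L0<..<Ls} um \<rho>m"
    by (rule steady_flow_subset[OF flow(1)]) auto
  note bern_m = steady_flow_bernoulli[OF \<open>L0 < Ls\<close> this cont(1,2), where F = F and c = L0]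
  have pos_m: "0 < \<rho>m x" if "x \<in> {L0<..<Ls}" for x
    using sup[of x] that by (simp add: supersonic_def)
  have m: "0 < \<rho>m x" "um x = J / \<rho>m x" "bern (\<rho>m x) = bern \<rho>0 + F x" if "x \<in> {L0..Ls}" for x
    using bern_m[OF pos_m _ _ _ that] F_derivative_subset[of _ "{L0..Ls}"] that ord init rho0 F_L0 by auto
  \<comment> \<open>Supersonicity is not assumed at \<open>Ls\<close>, and in the limit only the
    weak inequality survives. Strictness returns because the Bernoulli value stays above
    \<open>bern sonic\<close>.\<close>
  have "\<rho>m x \<le> sonic" if "x \<in> {L0..Ls}" for x
  proof (rule continuous_le_on_closure[of "{L0<..<Ls}" \<rho>m])
    show "\<rho>m y \<le> sonic" if "y \<in> {L0<..<Ls}" for y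
      using sup[of y] m[of y] sonic_type_iff(1)[of "\<rho>m y"] that by force
  qed (use cont ord that in auto)
  moreover have "\<rho>m x \<noteq> sonic" if "x \<in> {L0..Ls}" for x
    using m(3)[OF that] bern_supersonic_less[OF rho0] F_mono_le[of L0 x] F_L0 that ord by auto
  ultimately have m_sup: "\<rho>m x < sonic" if "x \<in> {L0..Ls}" for x
    using that by (simp add: less_le)
  have m_pre: "\<rho>m x = pre x" if "x \<in> {L0..Ls}" for x
    using sup_branch_bern[OF m(1)[OF that] m_sup[OF that]] m(3)[OF that] by (simp add: pre_def)
  then show "\<rho>m x = pre x \<and> um x = J / pre x" if "x \<in> {L0..Ls}" for x
    using m(2) that by simp

  have flux: "\<rho>p Ls * up Ls = J"
    using RH(1) m[of Ls] ord by simp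
  have pos_p: "0 < \<rho>p x" if "x \<in> {Ls<..<L1}" for x
    using sub[of x] that by (simp add: subsonic_def)
  note bern_p = steady_flow_bernoulli[OF \<open>Ls < L1\<close> flow(2) cont(3,4), where F = F and c = Ls]
  have p: "0 < \<rho>p x" "up x = J / \<rho>p x" "bern (\<rho>p x) = bern (\<rho>p Ls) + (F x - F Ls)" if "x \<in> {Ls..L1}" for x
    using bern_p[OF pos_p _ _ flux that] F_derivative_subset[of _ "{Ls..L1}"] that ord by auto
  have Lsm: "Ls \<in> {L0..Ls}" and Lsp: "Ls \<in> {Ls..L1}" using ord by auto
  have mom_eq: "mom (\<rho>p Ls) = mom (\<rho>m Ls)"
    using RH(2) m[OF Lsm] p[OF Lsp] by (simp add: momentum_flux_eq_mom)
  have "\<rho>m Ls < \<rho>p Ls"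
    using entropy pressure_less_iff m(1)[OF Lsm] p(1)[OF Lsp] by blast
  \<comment> \<open>\<open>mom\<close> is strictly decreasing up to \<open>sonic\<close>, so a
    larger density with the same momentum flux must lie beyond it. Entropy has already excluded
    equal densities.\<close>
  then have "sonic < \<rho>p Ls"
    using mom_supersonic_less[of "\<rho>m Ls" "\<rho>p Ls"] mom_eq m(1)[OF Lsm] by force
  then have behind: "\<rho>p Ls = behind Ls"
    using jump_branch_mom[of "\<rho>p Ls"] mom_eq m_pre[OF Lsm] by (simp add: behind_def)
  have "sonic \<le> \<rho>p x" if "x \<in> {Ls..L1}" for x
  proof (rule continuous_ge_on_closure[of "{Ls<..<L1}" \<rho>p])
    show "sonic \<le> \<rho>p y" if "y \<in> {Ls<..<L1}" for y
      using sub[of y] p[of y] sonic_type_iff(2)[of "\<rho>p y"] that by force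
  qed (use cont ord that in auto)
  moreover have "\<rho>p x \<noteq> sonic" if "x \<in> {Ls..L1}" for x
    using p(3)[OF that] bern_subsonic_less[OF order_refl \<open>sonic < \<rho>p Ls\<close>] F_mono_le[of Ls x] that ord by auto
  ultimately have p_sub: "sonic < \<rho>p x" if "x \<in> {Ls..L1}" for x
    using that by (metis less_le)
  have p_post: "\<rho>p x = post Ls x" if "x \<in> {Ls..L1}" for x
    using sub_branch_bern[OF p_sub[OF that]] p(3)[OF that] by (simp add: post_def behind)
  then show "\<rho>p x = post Ls x \<and> up x = J / post Ls x" if "x \<in> {Ls..L1}" for x
    using p(2) that by simp
  show "Pe = exit_pressure Ls"
    using exit p_post[of L1] ord by (simp add: exit_pressure_def)
qed

section \<open>Exit pressure as a function of the shock position\<close>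

lemma bern_post_exit:
  assumes "s \<in> {L0..L1}"
  shows "bern (post s L1) = bern (behind s) - bern (pre s) + bern \<rho>0 + F L1"
  using post(2)[OF assms, of L1] pre(3)[OF assms] assms by simp

text \<open>The endpoints \<open>L0\<close> and \<open>L1\<close> are included, although no shock
  sits there: their values become the bounds \<open>P0\<close> and \<open>P1\<close>.\<close>

lemma exit_pressure_less:
  assumes "L0 \<le> s" "s < t" "t \<le> L1"
  shows "exit_pressure t < exit_pressure s"
proof -
  have s: "s \<in> {L0..L1}" and t: "t \<in> {L0..L1}" using assms by auto
  have "pre t < pre s"
  proof (rule ccontr)
    assume "\<not> pre t < pre s"
    then have "bern (pre t) \<le> bern (pre s)"
      using bern_supersonic_less[of "pre s" "pre t"] pre[OF s] pre[OF t] by (cases "pre s = pre t") auto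
    then show False
      using pre(3)[OF s] pre(3)[OF t] F_mono[OF assms] by simp
  qed
  then have "mom (pre s) < mom (pre t)"
    using mom_supersonic_less pre[OF s] pre[OF t] by simp
  then have "behind s < behind t"
    using mom_subsonic_less[of "behind t" "behind s"] behind[OF s] behind[OF t]
    by (cases "behind s" "behind t" rule: linorder_cases) auto
  \<comment> \<open>The decreasing function \<open>bern - mom / sonic\<close> is applied to the pair
    behind the shock and to the pair ahead of it. On adding, the \<open>mom\<close> terms cancel,
    since \<open>mom\<close> agrees across each shock.\<close>
  then have "bern (behind t) - bern (pre t) < bern (behind s) - bern (pre s)"
    using bern_minus_mom_decreasing[OF _ \<open>behind s < behind t\<close>]
      bern_minus_mom_decreasing[OF _ \<open>pre t < pre s\<close>]
      behind[OF s] behind[OF t] pre[OF t] sonic_pos by simp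
  then have "bern (post t L1) < bern (post s L1)"
    unfolding bern_post_exit[OF s] bern_post_exit[OF t] by linarith
  moreover have sub: "sonic < post s L1" "sonic < post t L1"
    using post(1)[OF s] post(1)[OF t] assms by auto
  ultimately have "post t L1 < post s L1"
    using bern_subsonic_less[of "post s L1" "post t L1"] by (cases "post s L1" "post t L1" rule: linorder_cases) auto
  then show ?thesis
    unfolding exit_pressure_def using pressure_less_iff sub sonic_pos by simp
qed

text \<open>Prepares the intermediate value theorem that yields a shock position for each end
  pressure; continuity is inherited from the inverse branches and the potential
  \<open>F\<close>.\<close>

lemma continuous_on_exit_pressure: "continuous_on {L0..L1} exit_pressure"
  unfolding continuous_on_eq_continuous_within
proof
  fix s assume s: "s \<in> {L0..L1}"
  have "isCont bern (behind s)"
    using behind(1)[OF s] sonic_pos by (intro DERIV_isCont[OF has_derivative_bern]) simp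
  then have "continuous (at s within {L0..L1}) (\<lambda>s. bern (behind s))"
    using continuous_within_compose3[OF _ behind(3)[OF s]] by blast
  moreover have "continuous (at s within {L0..L1}) F"
    using F[OF s] by (rule DERIV_continuous)
  ultimately have c: "continuous (at s within {L0..L1}) (\<lambda>s. bern (behind s) + (F L1 - F s))"
    by (intro continuous_intros)
  have y: "bern sonic < bern (behind s) + (F L1 - F s)"
    using bern_subsonic_less[OF order_refl behind(1)[OF s]] F_mono_le[of s L1] s by simp
  have "continuous (at s within {L0..L1}) (\<lambda>s. post s L1)"
    unfolding post_def
    by (rule continuous_within_compose3[OF DERIV_isCont[OF sub_branch(3)[OF y]] c])
  then show "continuous (at s within {L0..L1}) exit_pressure"
    unfolding exit_pressure_def[abs_def] pressure_def
    using post(1)[OF s, of L1] s sonic_pos by (intro continuous_intros) auto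
qed

end

section \<open>Inverting the exit pressure, and conclusion\<close>

lemma strict_antimono_inverse_limits:
  fixes g h :: "real \<Rightarrow> real"
  assumes "a < b"
    and g: "\<And>x y. a \<le> x \<Longrightarrow> x < y \<Longrightarrow> y \<le> b \<Longrightarrow> g y < g x"
    and h: "\<And>p. p \<in> {g b<..<g a} \<Longrightarrow> h p \<in> {a<..<b} \<and> g (h p) = p"
  shows "strict_antimono_on {g b<..<g a} h"
    "(h \<longlongrightarrow> b) (at_right (g b))" "(h \<longlongrightarrow> a) (at_left (g a))"
proof -
  have gle: "g y \<le> g x" if "a \<le> x" "x \<le> y" "y \<le> b" for x y
    using g[of x y] that by (cases "x = y") auto
  \<comment> \<open>Comparing \<open>p\<close> with \<open>g x\<close> locates \<open>h p\<close>
    relative to \<open>x\<close>. Monotonicity and both limits of the inverse follow from this fact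
    and its mirror image.\<close>
  have above: "x < h p" if "p \<in> {g b<..<g a}" "a \<le> x" "x \<le> b" "p < g x" for x p
    using h[OF that(1)] gle[of "h p" x] that by force
  have below: "h p < x" if "p \<in> {g b<..<g a}" "a \<le> x" "x \<le> b" "g x < p" for x p
    using h[OF that(1)] gle[of x "h p"] that by force
  show "strict_antimono_on {g b<..<g a} h"
  proof (rule monotone_onI)
    fix p q assume "p \<in> {g b<..<g a}" "q \<in> {g b<..<g a}" "p < q"
    then show "h p > h q" using above[of p "h q"] h[of q] by force
  qed
  have "g b < g a" using g[of a b] \<open>a < b\<close> by simp
  show "(h \<longlongrightarrow> b) (at_right (g b))"
  proof (rule order_tendstoI)
    fix c assume "c < b"
    \<comment> \<open>The maximum keeps \<open>x\<close> inside the interval even when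
      \<open>c\<close> lies to the left of \<open>a\<close>.\<close>
    define x where "x = (max a c + b) / 2"
    have x: "a < x" "c < x" "x < b" using \<open>c < b\<close> \<open>a < b\<close> by (auto simp: x_def)
    have "\<forall>\<^sub>F p in at_right (g b). p \<in> {g b<..<g x}"
      using g[of x b] x by (intro eventually_at_right_real) auto
    then show "\<forall>\<^sub>F p in at_right (g b). c < h p"
    proof eventually_elim
      case (elim p)
      then show ?case using above[of p x] gle[of a x] x by force
    qed
  next
    fix c assume "b < c"
    have "\<forall>\<^sub>F p in at_right (g b). p \<in> {g b<..<g a}"
      using \<open>g b < g a\<close> by (rule eventually_at_right_real)
    then show "\<forall>\<^sub>F p in at_right (g b). h p < c"
      by eventually_elim (use h \<open>b < c\<close> in force)
  qed
  show "(h \<longlongrightarrow> a) (at_left (g a))"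
  proof (rule order_tendstoI)
    fix c assume "a < c"
    define x where "x = (min b c + a) / 2"
    have x: "a < x" "x < c" "x < b" using \<open>a < c\<close> \<open>a < b\<close> by (auto simp: x_def min_def)
    have "\<forall>\<^sub>F p in at_left (g a). p \<in> {g x<..<g a}"
      using g[of a x] x by (intro eventually_at_left_real) auto
    then show "\<forall>\<^sub>F p in at_left (g a). h p < c"
    proof eventually_elim
      case (elim p)
      then show ?case using below[of p x] gle[of x b] x by force
    qed
  next
    fix c assume "c < a"
    have "\<forall>\<^sub>F p in at_left (g a). p \<in> {g b<..<g a}"
      using \<open>g b < g a\<close> by (rule eventually_at_left_real)
    then show "\<forall>\<^sub>F p in at_left (g a). c < h p"
      by eventually_elim (use h \<open>c < a\<close> in force)
  qed
qed

theorem lemma1p1: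
  fixes \<gamma> L0 L1 u0 \<rho>0 :: real and f :: "real \<Rightarrow> real"
  assumes "1 < \<gamma>" and "\<gamma> < 3"
    and "L0 < L1"
    and "u0 > 0" and "\<rho>0 > 0"
    and "supersonic \<gamma> u0 \<rho>0"
    and "smooth_on {L0..L1} f"
    and "\<forall>x. L0 < x \<and> x < L1 \<longrightarrow> f x > 0"
  shows "\<exists>P1 P0 :: real. \<exists>Lsh :: real \<Rightarrow> real.
    0 < P1 \<and> P1 < P0 \<and>
    (\<forall>Pe\<in>{P1<..<P0}.
       \<exists>um \<rho>m up \<rho>p.
         transonic_shock \<gamma> f L0 L1 u0 \<rho>0 Pe (Lsh Pe) um \<rho>m up \<rho>p \<and>
         (\<forall>Ls vm rm vp rp.
            transonic_shock \<gamma> f L0 L1 u0 \<rho>0 Pe Ls vm rm vp rp \<longrightarrow>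
              Ls = Lsh Pe \<and>
              (\<forall>x\<in>{L0..Ls}. vm x = um x \<and> rm x = \<rho>m x) \<and>
              (\<forall>x\<in>{Ls..L1}. vp x = up x \<and> rp x = \<rho>p x))) \<and>
    strict_antimono_on {P1<..<P0} Lsh \<and>
    (Lsh \<longlongrightarrow> L1) (at_right P1) \<and>
    (Lsh \<longlongrightarrow> L0) (at_left P0)"
proof -
  define J where "J = \<rho>0 * u0"
  have u0: "u0 = J / \<rho>0" using \<open>\<rho>0 > 0\<close> by (simp add: J_def)
  define F where "F = (\<lambda>x. integral {L0..x} f)"
  interpret gas_flow \<gamma> J
    by unfold_locales (use assms in \<open>auto simp: J_def\<close>)
  have F: "(F has_real_derivative f x) (at x within {L0..L1})" if "x \<in> {L0..L1}" for x
    unfolding F_def using smooth_on_imp_continuous_on[OF assms(7)] that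
    by (rule integral_has_real_derivative)
  interpret nozzle_flow \<gamma> J f F L0 L1 \<rho>0
  proof unfold_locales
    \<comment> \<open>Positivity of \<open>f\<close> is available only in the open interval;
      continuity of \<open>F\<close> extends strict growth to \<open>L0\<close> and
      \<open>L1\<close>.\<close>
    show "F x < F y" if "L0 \<le> x" "x < y" "y \<le> L1" for x y
    proof (rule DERIV_pos_imp_increasing_open[OF \<open>x < y\<close>])
      show "\<exists>d. (F has_real_derivative d) (at z) \<and> 0 < d" if "x < z" "z < y" for z
        using F[of z] assms(8) that \<open>L0 \<le> x\<close> \<open>y \<le> L1\<close> at_within_Icc_at[of L0 z L1] by force
      show "continuous_on {x..y} F"
        using that by (intro DERIV_continuous_on[where D = f] DERIV_subset[OF F]) auto
    qed
    show "\<rho>0 < sonic"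
      using assms(5,6) sonic_type_iff(1) by (simp add: u0)
  qed (use assms F in \<open>auto simp: F_def\<close>)
  \<comment> \<open>The witnesses are \<open>P1 = ?G L1\<close> and \<open>P0 = ?G L0\<close>, the
    exit pressures of the limiting shock positions; \<open>Lsh\<close> inverts \<open>?G\<close>
    between them.\<close>
  let ?G = exit_pressure
  have "\<exists>s. s \<in> {L0<..<L1} \<and> ?G s = Pe" if Pe: "Pe \<in> {?G L1<..<?G L0}" for Pe
  proof -
    obtain s where "L0 \<le> s" "s \<le> L1" "?G s = Pe"
      using IVT2'[of ?G L1 Pe L0] Pe \<open>L0 < L1\<close> continuous_on_exit_pressure by force
    moreover have "s \<noteq> L0" "s \<noteq> L1" using Pe \<open>?G s = Pe\<close> by auto
    ultimately show ?thesis by (intro exI[of _ s]) auto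
  qed
  then obtain Lsh where Lsh: "\<And>Pe. Pe \<in> {?G L1<..<?G L0} \<Longrightarrow> Lsh Pe \<in> {L0<..<L1} \<and> ?G (Lsh Pe) = Pe"
    by metis
  have unique: "Ls = Lsh Pe" if "Pe \<in> {?G L1<..<?G L0}" "L0 < Ls" "Ls < L1" "?G Ls = Pe" for Ls Pe
    using exit_pressure_less[of Ls "Lsh Pe"] exit_pressure_less[of "Lsh Pe" Ls] Lsh[OF that(1)] that
    by (cases Ls "Lsh Pe" rule: linorder_cases) auto
  have "0 < ?G L1"
    using post(1)[of L1 L1] sonic_pos \<open>L0 < L1\<close> by (simp add: exit_pressure_def pressure_def)
  moreover have "?G L1 < ?G L0"
    using exit_pressure_less \<open>L0 < L1\<close> by simp
  moreover have "\<exists>um \<rho>m up \<rho>p.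
         transonic_shock \<gamma> f L0 L1 u0 \<rho>0 Pe (Lsh Pe) um \<rho>m up \<rho>p \<and>
         (\<forall>Ls vm rm vp rp.
            transonic_shock \<gamma> f L0 L1 u0 \<rho>0 Pe Ls vm rm vp rp \<longrightarrow>
              Ls = Lsh Pe \<and>
              (\<forall>x\<in>{L0..Ls}. vm x = um x \<and> rm x = \<rho>m x) \<and>
              (\<forall>x\<in>{Ls..L1}. vp x = up x \<and> rp x = \<rho>p x))"
    if Pe: "Pe \<in> {?G L1<..<?G L0}" for Pe
  proof (intro exI conjI allI impI)
    show "transonic_shock \<gamma> f L0 L1 u0 \<rho>0 Pe (Lsh Pe) (\<lambda>x. J / pre x) pre
        (\<lambda>x. J / post (Lsh Pe) x) (post (Lsh Pe))"
      using transonic_shock_exists[of "Lsh Pe"] Lsh[OF Pe] by (simp add: u0)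
  next
    fix Ls vm rm vp rp
    assume shock: "transonic_shock \<gamma> f L0 L1 u0 \<rho>0 Pe Ls vm rm vp rp"
    note u = transonic_shock_unique[OF shock[unfolded u0]]
    show Ls: "Ls = Lsh Pe"
      using shock u(1) by (intro unique[OF Pe]) (auto simp: transonic_shock_def)
    show "\<forall>x\<in>{L0..Ls}. vm x = J / pre x \<and> rm x = pre x"
      "\<forall>x\<in>{Ls..L1}. vp x = J / post (Lsh Pe) x \<and> rp x = post (Lsh Pe) x"
      using u(2,3) by (auto simp: Ls)
  qed
  moreover note strict_antimono_inverse_limits[OF \<open>L0 < L1\<close> exit_pressure_less Lsh]
  ultimately show ?thesis by blast
qed

end
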